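(* Let $n\geq 3$ be an integer, let $m=\sqrt n$, and set \[ a_n=\frac{m^2+m-1}{m(m+2)},\quad b_n=\frac{m+1}{m(m+2)},\quad c_n=\frac{1}{m(m+1)}, \] \[ d_n=\frac{m^3+2m^2+m+1}{m(m+1)(m+2)},\quad e_n=\frac{1}{m(m+1)(m+2)},\quad f_n=\frac{2m+3}{m(m+1)(m+2)}. \] Define the $n\times n$ matrix $A_n$ by: row $1$ is $(a_n,b_n,0,\dots,0)$; for $2\leq i\leq n-1$, row $i$ has $A_n(i,1)=0$, $A_n(i,2)=c_n$, $A_n(i,i+1)=d_n$, and $A_n(i,j)=e_n$ for all $3\leq j\leq n$ with $j\neq i+1$; row $n$ is $(b_n,f_n,c_n,c_n,\dots,c_n)$. Then: (1) $A_n$ is doubly stochastic; (2) every nontrivial eigenvalue of $A_n$ is $0$; (3) $\frac{1}{6\sqrt n}\leq\phi(A_n)\leq\frac{1}{\sqrt n}$; (4) consequently $\phi(A_n)\leq\frac{1-\mathrm{Re}\,\lambda_2(A_n)}{\sqrt n}$, and thus $\Gamma(n)\leq\frac{1}{\sqrt n}$.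
   Context: A doubly stochastic matrix is nonnegative with all row and column sums equal to $1$. Its trivial eigenvalue is $1$ (eigenvector the all-ones vector, one copy); the other $n-1$ eigenvalues (with multiplicity) are the nontrivial ones, and $\lambda_2(A)$ denotes a nontrivial eigenvalue of maximal real part. Edge expansion: $\phi(A)=\min_{S\subseteq[n],\,S\neq\emptyset,\,|S|\leq n/2}\frac{1}{|S|}\sum_{i\in S,j\notin S}A_{i,j}$. $\Gamma(n)=\min\{\phi(A)/(1-\mathrm{Re}\,\lambda_2(A)) : A \text{ an } n\times n \text{ doubly stochastic matrix}\}$. *)

theory Defs
  imports Complex_Main "Jordan_Normal_Form.Char_Poly"
begin

definition doubly_stochastic :: "nat \<Rightarrow> real mat \<Rightarrow> bool" where
  "doubly_stochastic n A \<longleftrightarrow>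
     A \<in> carrier_mat n n \<and>
     (\<forall>i<n. \<forall>j<n. 0 \<le> A $$ (i, j)) \<and>
     (\<forall>i<n. (\<Sum>j<n. A $$ (i, j)) = 1) \<and>
     (\<forall>j<n. (\<Sum>i<n. A $$ (i, j)) = 1)"

text \<open>Complex eigenvalues with algebraic multiplicity, one copy of the trivial eigenvalue 1
  removed.\<close>

definition nontrivial_eigenvalues :: "real mat \<Rightarrow> complex multiset" where
  "nontrivial_eigenvalues A = proots (char_poly (map_mat complex_of_real A)) - {#1#}"

text \<open>The choice among nontrivial eigenvalues of maximal real part is arbitrary; only the real
  part, which does not depend on it, is ever used.\<close>

definition lambda2 :: "real mat \<Rightarrow> complex" where
  "lambda2 A = arg_max_on Re (set_mset (nontrivial_eigenvalues A))"

definition edge_expansion :: "real mat \<Rightarrow> real" where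
  "edge_expansion A =
     (let n = dim_row A in
      Min {(\<Sum>i\<in>S. \<Sum>j\<in>{..<n} - S. A $$ (i, j)) / real (card S) | S.
           S \<subseteq> {..<n} \<and> S \<noteq> {} \<and> real (card S) \<le> real n / 2})"

text \<open>Matrices with \<open>Re \<lambda>\<^sub>2 = 1\<close> (the reducible ones, for which also \<open>\<phi> = 0\<close>) must be left out:
  their ratio is the undefined 0/0, which HOL would evaluate to 0, collapsing the minimum to 0.
  The minimum over the remaining set is rendered by the infimum, which agrees with the minimum
  when that is attained; the set is bounded below by 0.\<close>

definition Gamma_ratio :: "nat \<Rightarrow> real" where
  "Gamma_ratio n =
     Inf {edge_expansion A / (1 - Re (lambda2 A)) | A.
          doubly_stochastic n A \<and> Re (lambda2 A) \<noteq> 1}"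

text \<open>The case distinction uses the indices \<open>i, j \<in> {1..n}\<close>; matrix positions are 0-based.\<close>

definition A_mat :: "nat \<Rightarrow> real mat" where
  "A_mat n =
     (let m = sqrt (real n);
          a = (m^2 + m - 1) / (m * (m + 2));
          b = (m + 1) / (m * (m + 2));
          c = 1 / (m * (m + 1));
          d = (m^3 + 2 * m^2 + m + 1) / (m * (m + 1) * (m + 2));
          e = 1 / (m * (m + 1) * (m + 2));
          f = (2 * m + 3) / (m * (m + 1) * (m + 2));
          entry = (\<lambda>i j.
            if i = 1 then (if j = 1 then a else if j = 2 then b else 0)
            else if i = n then (if j = 1 then b else if j = 2 then f else c)
            else (if j = 1 then 0 else if j = 2 then c else if j = i + 1 then d else e))
      in mat n n (\<lambda>(i, j). entry (i + 1) (j + 1)))"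

end

theory Submission
  imports Defs "Jordan_Normal_Form.Schur_Decomposition"
begin

text \<open>Suppose \<open>A x = z x\<close> with \<open>z \<noteq> 0, 1\<close>. The column sums give \<open>\<Sum> x = 0\<close>, after which the middle
  rows read \<open>t (x\<^sub>i\<^sub>+\<^sub>1 - k) = z (x\<^sub>i - k)\<close> with \<open>t = d - e\<close> and \<open>k = x\<^sub>1 / (m + 1)\<close>, and the last row reads
  \<open>x\<^sub>n = k\<close>. Going backwards, \<open>x\<^sub>2 = \<dots> = x\<^sub>n = k\<close>, so \<open>0 = \<Sum> x = m x\<^sub>1\<close> and \<open>x = 0\<close>. Hence all
  eigenvalues are 0 or 1, and since the trace is 1, the eigenvalue 1 is simple.

  For the expansion, \<open>A\<close> dominates entrywise the sum of \<open>e\<close> times the complete graph on \<open>{2..n}\<close> and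
  \<open>b\<close> times the cycle \<open>1 \<rightarrow> 2 \<rightarrow> \<dots> \<rightarrow> n \<rightarrow> 1\<close>, which leaves every proper subset at least once. A
  set of size \<open>s \<le> n / 2\<close> therefore has cut at least \<open>(s - 1) (n - s) e + b \<ge> s / (6 m)\<close>. The set
  \<open>{1}\<close> has cut \<open>b \<le> 1 / m\<close>.\<close>

section \<open>Trace and multiplicity of the eigenvalue 1\<close>

lemma trace_mult_comm:
  fixes A B :: "'a::comm_semiring_0 mat"
  assumes A: "A \<in> carrier_mat n n" and B: "B \<in> carrier_mat n n"
  shows "(\<Sum>i<n. (A * B) $$ (i, i)) = (\<Sum>i<n. (B * A) $$ (i, i))"
proof -
  have "(\<Sum>i<n. (A * B) $$ (i, i)) = (\<Sum>i<n. \<Sum>j<n. A $$ (i, j) * B $$ (j, i))"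
    using A B by (intro sum.cong) (auto simp: scalar_prod_def atLeast0LessThan)
  also have "\<dots> = (\<Sum>j<n. \<Sum>i<n. A $$ (i, j) * B $$ (j, i))"
    by (rule sum.swap)
  also have "\<dots> = (\<Sum>i<n. (B * A) $$ (i, i))"
    using A B by (intro sum.cong) (auto simp: scalar_prod_def atLeast0LessThan mult.commute)
  finally show ?thesis .
qed

text \<open>In the Schur form \<open>A = P * B * Q\<close> the diagonal of \<open>B\<close> is
  \<open>es\<close>. Moving \<open>P\<close> cyclically to the end and cancelling
  \<open>Q * P\<close> keeps the trace.\<close>

lemma trace_eq_sum_list_roots:
  fixes A :: "complex mat"
  assumes A: "A \<in> carrier_mat n n"
    and cp: "char_poly A = (\<Prod>a\<leftarrow>es. [:- a, 1:])"
  shows "(\<Sum>i<n. A $$ (i, i)) = sum_list es"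
proof -
  obtain B P Q where BPQ: "schur_decomposition A es = (B, P, Q)"
    by (cases "schur_decomposition A es") auto
  from schur_decomposition[OF A cp BPQ]
  have sim: "similar_mat_wit A B P Q" and diag: "diag_mat B = es" by auto
  note D = similar_mat_witD2[OF A sim]
  have "(\<Sum>i<n. A $$ (i, i)) = (\<Sum>i<n. (P * (B * Q)) $$ (i, i))"
    using D by (simp add: assoc_mult_mat)
  also have "\<dots> = (\<Sum>i<n. (B * Q * P) $$ (i, i))"
    using D by (intro trace_mult_comm) auto
  also have "B * Q * P = B"
    using D by (simp add: assoc_mult_mat[of B n n Q n P n])
  also have "(\<Sum>i<n. B $$ (i, i)) = sum_list (diag_mat B)"
    using D by (simp add: diag_mat_def interv_sum_list_conv_sum_set_nat atLeast0LessThan)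
  finally show ?thesis using diag by simp
qed

lemma proots_prod_linear_factors:
  fixes es :: "'a::idom list"
  shows "proots (\<Prod>a\<leftarrow>es. [:- a, 1:]) = mset es"
proof (induction es)
  case (Cons a es)
  have "(\<Prod>a\<leftarrow>es. [:- a, 1:]) \<noteq> 0"
    by (auto simp: prod_list_zero_iff)
  with Cons show ?case by (simp add: proots_mult del: mult_pCons_left)
qed simp

text \<open>The roots with multiplicity sum to the trace, and a list of zeros and ones sums to its
  number of ones. Simplicity of the eigenvalue 1 thus becomes a trace computation.\<close>

lemma count_one_char_poly_roots_eq_trace:
  fixes A :: "complex mat"
  assumes A: "A \<in> carrier_mat n n"
    and ev: "\<And>z. eigenvalue A z \<Longrightarrow> z = 0 \<or> z = 1"
  shows "of_nat (count (proots (char_poly A)) 1) = (\<Sum>i<n. A $$ (i, i))"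
proof -
  obtain es where cp: "char_poly A = (\<Prod>a\<leftarrow>es. [:- a, 1:])"
    using char_poly_factorized[OF A] by blast
  have "set es \<subseteq> {0, 1}"
  proof
    fix z assume "z \<in> set es"
    then have "poly (char_poly A) z = 0"
      unfolding cp by (induction es) auto
    with ev eigenvalue_root_char_poly[OF A] show "z \<in> {0, 1}" by blast
  qed
  then have "sum_list es = of_nat (count (mset es) 1)"
    by (induction es) auto
  with trace_eq_sum_list_roots[OF A cp] show ?thesis
    by (simp only: cp proots_prod_linear_factors)
qed

section \<open>Eigenvalues of doubly stochastic matrices and \<open>lambda2\<close>\<close>

lemma eigenvalue_coordinates:
  assumes A: "A \<in> carrier_mat n n" and "eigenvalue A z"
  obtains x where "\<And>i. i < n \<Longrightarrow> (\<Sum>j<n. A $$ (i, j) * x j) = z * x i" "\<exists>i<n. x i \<noteq> 0"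
proof -
  obtain v where v: "v \<in> carrier_vec n" "v \<noteq> 0\<^sub>v n" "A *\<^sub>v v = z \<cdot>\<^sub>v v"
    using assms unfolding eigenvalue_def eigenvector_def by auto
  have "(\<Sum>j<n. A $$ (i, j) * v $ j) = z * v $ i" if "i < n" for i
  proof -
    have "(\<Sum>j<n. A $$ (i, j) * v $ j) = (A *\<^sub>v v) $ i"
      using that A v(1) by (auto simp: scalar_prod_def atLeast0LessThan)
    then show ?thesis using v that by auto
  qed
  moreover have "\<exists>i<n. v $ i \<noteq> 0"
    using v(1,2) by (auto intro!: eq_vecI)
  ultimately show thesis by (rule that)
qed

text \<open>At a coordinate \<open>x i\<close> of largest modulus \<open>M\<close>, the number
  \<open>z * x i\<close> is a convex combination of coordinates, so its modulus is at most
  \<open>M\<close>.\<close>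

lemma doubly_stochastic_eigenvalue_norm_le_1:
  assumes ds: "doubly_stochastic n A" and ev: "eigenvalue (map_mat complex_of_real A) z"
  shows "cmod z \<le> 1"
proof -
  have A: "map_mat complex_of_real A \<in> carrier_mat n n" and A': "A \<in> carrier_mat n n"
    using ds by (auto simp: doubly_stochastic_def)
  obtain x where x: "\<And>i. i < n \<Longrightarrow> (\<Sum>j<n. map_mat complex_of_real A $$ (i, j) * x j) = z * x i"
    and nz: "\<exists>i<n. x i \<noteq> 0"
    using eigenvalue_coordinates[OF A ev] by blast
  define M where "M = Max ((\<lambda>i. cmod (x i)) ` {..<n})"
  have le: "cmod (x j) \<le> M" if "j < n" for j
    unfolding M_def using that by (intro Max_ge) auto
  have "M \<in> (\<lambda>i. cmod (x i)) ` {..<n}"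
    unfolding M_def using nz by (intro Max_in) auto
  then obtain i where i: "i < n" "M = cmod (x i)" by auto
  have "M > 0" using nz le by (metis norm_le_zero_iff not_le order_trans)
  have "cmod z * M = cmod (\<Sum>j<n. complex_of_real (A $$ (i, j)) * x j)"
    using x[OF i(1)] i A' by (simp add: norm_mult)
  also have "\<dots> \<le> (\<Sum>j<n. A $$ (i, j) * M)"
  proof (intro sum_norm_le)
    fix j assume "j \<in> {..<n}"
    then have "0 \<le> A $$ (i, j)" "cmod (x j) \<le> M"
      using ds i(1) le by (auto simp: doubly_stochastic_def)
    then show "cmod (complex_of_real (A $$ (i, j)) * x j) \<le> A $$ (i, j) * M"
      by (simp add: norm_mult mult_left_mono)
  qed
  also have "\<dots> = M"
    using ds i(1) by (simp add: doubly_stochastic_def flip: sum_distrib_right)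
  finally show ?thesis using \<open>M > 0\<close> by simp
qed

text \<open>\<open>lambda2\<close> is a Hilbert choice, so a maximizer has to exist: the
  characteristic polynomial has \<open>n\<close> complex roots, and removing one copy of 1 leaves a
  nonempty finite multiset.\<close>

lemma lambda2_in_nontrivial_eigenvalues:
  assumes A: "A \<in> carrier_mat n n" and "n \<ge> 2"
  shows "lambda2 A \<in># nontrivial_eigenvalues A"
proof -
  have "size (proots (char_poly (map_mat complex_of_real A))) = n"
    using degree_monic_char_poly[of "map_mat complex_of_real A" n] A by (simp add: size_proots_complex)
  then have ne: "nontrivial_eigenvalues A \<noteq> {#}"
    using \<open>n \<ge> 2\<close> size_Diff_submset[of "{#1#}" "proots (char_poly (map_mat complex_of_real A))"]
    by (auto simp: nontrivial_eigenvalues_def Diff_eq_empty_iff_mset dest!: size_mset_mono)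
  let ?E = "set_mset (nontrivial_eigenvalues A)"
  have "Max (Re ` ?E) \<in> Re ` ?E" using ne by (intro Max_in) auto
  then obtain z where z: "z \<in> ?E" "Re z = Max (Re ` ?E)" by auto
  have "is_arg_max Re (\<lambda>x. x \<in> ?E) z"
    using z by (auto simp: is_arg_max_linorder)
  then have "is_arg_max Re (\<lambda>x. x \<in> ?E) (lambda2 A)"
    unfolding lambda2_def arg_max_on_def arg_max_def by (rule someI)
  then show ?thesis by (simp add: is_arg_max_def)
qed

text \<open>This keeps the denominators in \<open>Gamma_ratio\<close> nonnegative, which bounds the
  ratios below.\<close>

lemma Re_lambda2_le_1:
  assumes ds: "doubly_stochastic n A" and "n \<ge> 2"
  shows "Re (lambda2 A) \<le> 1"
proof -
  have A: "A \<in> carrier_mat n n" "map_mat complex_of_real A \<in> carrier_mat n n"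
    using ds by (auto simp: doubly_stochastic_def)
  have "lambda2 A \<in># proots (char_poly (map_mat complex_of_real A))"
    using lambda2_in_nontrivial_eigenvalues[OF A(1) \<open>n \<ge> 2\<close>]
    unfolding nontrivial_eigenvalues_def by (rule in_diffD)
  \<comment> \<open>\<open>proots 0\<close> is empty, so membership excludes the zero
    polynomial.\<close>
  then have "poly (char_poly (map_mat complex_of_real A)) (lambda2 A) = 0"
    by (cases "char_poly (map_mat complex_of_real A) = 0") auto
  then have "cmod (lambda2 A) \<le> 1"
    using eigenvalue_root_char_poly[OF A(2)] doubly_stochastic_eigenvalue_norm_le_1[OF ds] by blast
  then show ?thesis using complex_Re_le_cmod order_trans by blast
qed

section \<open>Edge expansion, \<open>Gamma_ratio\<close> and cyclic cuts\<close>

lemma finite_cut_ratios: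
  "finite {(\<Sum>i\<in>S. \<Sum>j\<in>{..<n} - S. A $$ (i, j)) / real (card S) | S.
     S \<subseteq> {..<n} \<and> S \<noteq> {} \<and> real (card S) \<le> real n / 2}"
  by (rule finite_subset[of _
        "(\<lambda>S. (\<Sum>i\<in>S. \<Sum>j\<in>{..<n} - S. A $$ (i, j)) / real (card S)) ` Pow {..<n}"]) auto

lemma edge_expansion_le:
  assumes "A \<in> carrier_mat n n" "S \<subseteq> {..<n}" "S \<noteq> {}" "real (card S) \<le> real n / 2"
  shows "edge_expansion A \<le> (\<Sum>i\<in>S. \<Sum>j\<in>{..<n} - S. A $$ (i, j)) / real (card S)"
proof -
  have [simp]: "dim_row A = n" using assms(1) by auto
  show ?thesis
    unfolding edge_expansion_def Let_def using assms(2-)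
    by (intro Min_le) (auto simp: finite_cut_ratios)
qed

lemma edge_expansion_ge:
  assumes "A \<in> carrier_mat n n" "n \<ge> 2"
    and "\<And>S. S \<subseteq> {..<n} \<Longrightarrow> S \<noteq> {} \<Longrightarrow> real (card S) \<le> real n / 2 \<Longrightarrow>
           r \<le> (\<Sum>i\<in>S. \<Sum>j\<in>{..<n} - S. A $$ (i, j)) / real (card S)"
  shows "r \<le> edge_expansion A"
proof -
  have [simp]: "dim_row A = n" using assms(1) by auto
  \<comment> \<open>The singleton is admissible, so the minimum is taken over a nonempty
    set.\<close>
  have "{0} \<subseteq> {..<n} \<and> {0} \<noteq> ({}::nat set) \<and> real (card {0::nat}) \<le> real n / 2"
    using \<open>n \<ge> 2\<close> by auto
  then show ?thesis
    unfolding edge_expansion_def Let_def using assms(3)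
    by (intro Min.boundedI) (auto simp: finite_cut_ratios simp del: card_insert_disjoint)
qed

lemma edge_expansion_nonneg:
  assumes "doubly_stochastic n A" "n \<ge> 2"
  shows "0 \<le> edge_expansion A"
proof (rule edge_expansion_ge)
  show "A \<in> carrier_mat n n" using assms(1) by (simp add: doubly_stochastic_def)
  fix S assume "S \<subseteq> {..<n}"
  then have "0 \<le> A $$ (i, j)" if "i \<in> S" "j \<in> {..<n} - S" for i j
    using assms(1) that unfolding doubly_stochastic_def by blast
  then show "0 \<le> (\<Sum>i\<in>S. \<Sum>j\<in>{..<n} - S. A $$ (i, j)) / real (card S)"
    by (intro divide_nonneg_nonneg sum_nonneg) auto
qed (rule assms(2))

text \<open>A real \<open>Inf\<close> lies below the members only if the set is bounded below; 0 is
  such a bound because expansions and denominators are nonnegative.\<close>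

lemma Gamma_ratio_le:
  assumes "doubly_stochastic n A" "n \<ge> 2" "Re (lambda2 A) \<noteq> 1"
  shows "Gamma_ratio n \<le> edge_expansion A / (1 - Re (lambda2 A))"
  unfolding Gamma_ratio_def
proof (rule cInf_lower)
  show "bdd_below {edge_expansion A / (1 - Re (lambda2 A)) | A.
          doubly_stochastic n A \<and> Re (lambda2 A) \<noteq> 1}"
    using \<open>n \<ge> 2\<close> edge_expansion_nonneg Re_lambda2_le_1
    by (intro bdd_belowI[of _ 0]) (auto intro!: divide_nonneg_nonneg)
qed (use assms in auto)

text \<open>A nonempty set closed under the cyclic successor contains the whole cycle.\<close>

lemma cyclic_successor_leaves_proper_subset:
  assumes "S \<subseteq> {..<n}" "S \<noteq> {}" "S \<noteq> {..<n}"
  obtains i where "i \<in> S" "Suc i mod n \<in> {..<n} - S"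
proof (rule ccontr)
  assume contra: "\<not> thesis"
  obtain x where x: "x \<in> S" "x < n" using assms by auto
  have step: "Suc i mod n \<in> S" if "i \<in> S" for i
    using contra that x(2) \<open>\<And>i. i \<in> S \<Longrightarrow> Suc i mod n \<in> {..<n} - S \<Longrightarrow> thesis\<close> by auto
  have reach: "(x + k) mod n \<in> S" for k
  proof (induction k)
    case (Suc k)
    then have "Suc ((x + k) mod n) mod n \<in> S" by (rule step)
    then show ?case by (simp add: mod_Suc_eq)
  qed (use x in simp)
  \<comment> \<open>From \<open>x\<close>, the number \<open>n - x + y\<close> of steps leads to
    \<open>n + y\<close>, which is \<open>y\<close> modulo \<open>n\<close>.\<close>
  have "y \<in> S" if "y < n" for y
    using reach[of "n - x + y"] x that by simp
  with assms show False by auto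
qed

section \<open>The entries of the matrix and their identities\<close>

locale extremal_matrix =
  fixes n :: nat and m a b c d e f :: real
  assumes n_ge_3: "n \<ge> 3"
    and m_def: "m = sqrt (real n)"
    and a_def: "a = (m^2 + m - 1) / (m * (m + 2))"
    and b_def: "b = (m + 1) / (m * (m + 2))"
    and c_def: "c = 1 / (m * (m + 1))"
    and d_def: "d = (m^3 + 2 * m^2 + m + 1) / (m * (m + 1) * (m + 2))"
    and e_def: "e = 1 / (m * (m + 1) * (m + 2))"
    and f_def: "f = (2 * m + 3) / (m * (m + 1) * (m + 2))"
begin

lemma real_n: "real n = m^2"
  by (simp add: m_def)

lemma m_gt_1: "m > 1"
  using n_ge_3 by (simp add: m_def)

lemma entries_pos: "a > 0" "b > 0" "c > 0" "d > 0" "e > 0" "f > 0"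
proof -
  have "m^2 > 1" using m_gt_1 by (simp add: one_less_power)
  with m_gt_1 have "m^2 + m - 1 > 0" by linarith
  then show "a > 0" "b > 0" "c > 0" "d > 0" "e > 0" "f > 0"
    unfolding a_def b_def c_def d_def e_def f_def using m_gt_1
    by (auto intro!: divide_pos_pos mult_pos_pos add_pos_pos)
qed

text \<open>Over the common denominator of \<open>e\<close>, every entry is a polynomial in
  \<open>m\<close> times \<open>e\<close>. Later identities between entries become polynomial
  identities in \<open>m\<close>, and the last relation turns the common value into 1.\<close>

lemma entry_relations:
  "c = (m + 2) * e" "b = (m + 1)^2 * e" "f = (2 * m + 3) * e"
  "a = (m^2 + m - 1) * (m + 1) * e" "d = (m^3 + 2 * m^2 + m + 1) * e"
  "m * (m + 1) * (m + 2) * e = 1"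
proof -
  have "m \<noteq> 0" "m + 1 \<noteq> 0" "m + 2 \<noteq> 0" using m_gt_1 by auto
  then show "c = (m + 2) * e" "b = (m + 1)^2 * e" "f = (2 * m + 3) * e"
    "a = (m^2 + m - 1) * (m + 1) * e" "d = (m^3 + 2 * m^2 + m + 1) * e"
    "m * (m + 1) * (m + 2) * e = 1"
    unfolding a_def b_def c_def d_def e_def f_def
    by (simp_all add: divide_simps power2_eq_square)
qed

lemma first_line_sum: "a + b = 1"
proof -
  have "a + b = m * (m + 1) * (m + 2) * e"
    unfolding entry_relations(1-5) by (simp add: algebra_simps power2_eq_square power3_eq_cube)
  then show ?thesis using entry_relations(6) by simp
qed

lemma middle_line_sum: "c + d + (real n - 3) * e = 1"
proof -
  have "c + d + (real n - 3) * e = m * (m + 1) * (m + 2) * e"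
    unfolding entry_relations(1-5) real_n by (simp add: algebra_simps power2_eq_square power3_eq_cube)
  then show ?thesis using entry_relations(6) by simp
qed

lemma last_line_sum: "b + f + (real n - 2) * c = 1"
proof -
  have "b + f + (real n - 2) * c = m * (m + 1) * (m + 2) * e"
    unfolding entry_relations(1-5) real_n by (simp add: algebra_simps power2_eq_square power3_eq_cube)
  then show ?thesis using entry_relations(6) by simp
qed

text \<open>The diagonal holds \<open>a\<close> first, \<open>c\<close> in the second and last
  positions, and \<open>e\<close> in the remaining \<open>n - 3\<close>, so this is the
  trace.\<close>

lemma diagonal_sum: "a + 2 * c + (real n - 3) * e = 1"
proof -
  have "a + 2 * c + (real n - 3) * e = m * (m + 1) * (m + 2) * e"
    unfolding entry_relations(1-5) real_n by (simp add: algebra_simps power2_eq_square power3_eq_cube)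
  then show ?thesis using entry_relations(6) by simp
qed

section \<open>Rows, columns and double stochasticity\<close>

lemma A_mat_carrier: "A_mat n \<in> carrier_mat n n"
  by (simp add: A_mat_def Let_def)

text \<open>Indices are 0-based from here on, as in the matrix library.\<close>

lemma A_mat_index:
  assumes "i < n" "j < n"
  shows "A_mat n $$ (i, j) =
    (if i = 0 then (if j = 0 then a else if j = 1 then b else 0)
     else if i = n - 1 then (if j = 0 then b else if j = 1 then f else c)
     else (if j = 0 then 0 else if j = 1 then c else if j = Suc i then d else e))"
proof -
  have "Suc i = n \<longleftrightarrow> i = n - 1" using assms by auto
  then show ?thesis
    using assms unfolding A_mat_def Let_def a_def b_def c_def d_def e_def f_def m_def by simp
qed

lemma sum_split_first_two:
  fixes g :: "nat \<Rightarrow> 'b::comm_monoid_add"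
  shows "(\<Sum>j<n. g j) = g 0 + (g 1 + (\<Sum>j=2..<n. g j))"
proof -
  have "{..<n} = insert 0 (insert 1 {2..<n})" using n_ge_3 by auto
  then show ?thesis by simp
qed

lemma sum_split_first_last:
  fixes g :: "nat \<Rightarrow> 'b::comm_monoid_add"
  shows "(\<Sum>i<n. g i) = g 0 + (g (n - 1) + (\<Sum>i=1..<n-1. g i))"
proof -
  have "{..<n} = insert 0 (insert (n - 1) {1..<n-1})" using n_ge_3 by auto
  then show ?thesis using n_ge_3 by simp
qed

text \<open>The scalars are kept general in the row formulas: the real constant 1 gives the row
  sums, a complex eigenvector gives the eigenvalue equations.\<close>

lemma A_mat_row_first:
  fixes x :: "nat \<Rightarrow> 'b::{real_algebra_1,comm_ring_1}"
  shows "(\<Sum>j<n. of_real (A_mat n $$ (0, j)) * x j) = of_real a * x 0 + of_real b * x 1"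
  using n_ge_3 by (simp add: sum_split_first_two A_mat_index)

lemma A_mat_row_last:
  fixes x :: "nat \<Rightarrow> 'b::{real_algebra_1,comm_ring_1}"
  shows "(\<Sum>j<n. of_real (A_mat n $$ (n - 1, j)) * x j) =
    of_real b * x 0 + of_real f * x 1 + of_real c * (\<Sum>j=2..<n. x j)"
  using n_ge_3 by (simp add: sum_split_first_two A_mat_index sum_distrib_left)

lemma A_mat_row_middle:
  fixes x :: "nat \<Rightarrow> 'b::{real_algebra_1,comm_ring_1}"
  assumes i: "0 < i" "i < n - 1"
  shows "(\<Sum>j<n. of_real (A_mat n $$ (i, j)) * x j) =
    of_real c * x 1 + of_real e * (\<Sum>j=2..<n. x j) + of_real (d - e) * x (Suc i)"
proof -
  \<comment> \<open>The row is constantly \<open>e\<close> on these columns except for a surplus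
    \<open>d - e\<close> at \<open>Suc i\<close>, which lies in the range since
    \<open>0 < i < n - 1\<close>.\<close>
  have "(\<Sum>j=2..<n. of_real (A_mat n $$ (i, j)) * x j) =
    (\<Sum>j=2..<n. of_real e * x j + (if j = Suc i then of_real (d - e) * x j else 0))"
    using i by (intro sum.cong) (auto simp: A_mat_index algebra_simps)
  also have "\<dots> = of_real e * (\<Sum>j=2..<n. x j) + of_real (d - e) * x (Suc i)"
    using i by (simp add: sum.distrib sum_distrib_left)
  finally show ?thesis
    using i by (simp add: sum_split_first_two A_mat_index add.assoc)
qed

lemma A_mat_row_sum:
  assumes "i < n"
  shows "(\<Sum>j<n. A_mat n $$ (i, j)) = 1"
proof -
  consider "i = 0" | "i = n - 1" | "0 < i" "i < n - 1" using assms by linarith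
  then show ?thesis
  proof cases
    case 1
    then show ?thesis using A_mat_row_first[of "\<lambda>_. 1::real"] first_line_sum by simp
  next
    case 2
    then show ?thesis
      using A_mat_row_last[of "\<lambda>_. 1::real"] last_line_sum n_ge_3 by (simp add: of_nat_diff algebra_simps)
  next
    case 3
    then show ?thesis
      using A_mat_row_middle[of i "\<lambda>_. 1::real"] middle_line_sum n_ge_3
      by (simp add: of_nat_diff algebra_simps)
  qed
qed

lemma A_mat_column_sum:
  assumes "j < n"
  shows "(\<Sum>i<n. A_mat n $$ (i, j)) = 1"
proof -
  consider "j = 0" | "j = 1" | "2 \<le> j" by linarith
  then show ?thesis
  proof cases
    case 1
    then show ?thesis using n_ge_3 first_line_sum by (simp add: sum_split_first_last A_mat_index)
  next
    case 2
    then show ?thesis using n_ge_3 last_line_sum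
      by (simp add: sum_split_first_last A_mat_index of_nat_diff algebra_simps)
  next
    case 3
    \<comment> \<open>Among the middle rows, column \<open>j\<close> meets \<open>d\<close> only in
      row \<open>j - 1\<close>.\<close>
    have "(\<Sum>i=1..<n-1. A_mat n $$ (i, j)) =
      (\<Sum>i=1..<n-1. e + (if i = j - 1 then d - e else 0))"
      using 3 assms by (intro sum.cong) (auto simp: A_mat_index)
    then have "(\<Sum>i=1..<n-1. A_mat n $$ (i, j)) = (real n - 2) * e + (d - e)"
      using 3 assms by (auto simp: sum.distrib of_nat_diff)
    moreover have "A_mat n $$ (0, j) = 0" "A_mat n $$ (n - 1, j) = c"
      using 3 assms by (auto simp: A_mat_index)
    ultimately show ?thesis
      using middle_line_sum unfolding sum_split_first_last by (simp add: algebra_simps)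
  qed
qed

lemma A_mat_doubly_stochastic: "doubly_stochastic n (A_mat n)"
proof -
  have "0 \<le> A_mat n $$ (i, j)" if "i < n" "j < n" for i j
    using that entries_pos by (simp add: A_mat_index)
  then show ?thesis
    unfolding doubly_stochastic_def
    using A_mat_carrier A_mat_row_sum A_mat_column_sum by blast
qed

section \<open>Trace and eigenvalues of the matrix\<close>

lemma A_mat_trace: "(\<Sum>i<n. A_mat n $$ (i, i)) = 1"
proof -
  have "(\<Sum>i=1..<n-1. A_mat n $$ (i, i)) = (\<Sum>i=1..<n-1. e + (if i = 1 then c - e else 0))"
    by (intro sum.cong) (auto simp: A_mat_index)
  then have "(\<Sum>i=1..<n-1. A_mat n $$ (i, i)) = (real n - 2) * e + (c - e)"
    using n_ge_3 by (auto simp: sum.distrib of_nat_diff)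
  moreover have "A_mat n $$ (0, 0) = a" "A_mat n $$ (n - 1, n - 1) = c"
    using n_ge_3 by (auto simp: A_mat_index)
  ultimately show ?thesis
    using diagonal_sum unfolding sum_split_first_last by (simp add: algebra_simps)
qed

lemma A_mat_eigenvalue:
  assumes ev: "eigenvalue (map_mat complex_of_real (A_mat n)) z"
  shows "z = 0 \<or> z = 1"
proof (rule ccontr)
  assume z: "\<not> (z = 0 \<or> z = 1)"
  have "map_mat complex_of_real (A_mat n) \<in> carrier_mat n n"
    using A_mat_carrier by simp
  from eigenvalue_coordinates[OF this ev] obtain x where
    x': "\<And>i. i < n \<Longrightarrow> (\<Sum>j<n. map_mat complex_of_real (A_mat n) $$ (i, j) * x j) = z * x i"
    and nz: "\<exists>i<n. x i \<noteq> 0" by blast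
  have x: "(\<Sum>j<n. of_real (A_mat n $$ (i, j)) * x j) = z * x i" if "i < n" for i
    using x'[OF that] that A_mat_carrier by simp
  \<comment> \<open>Summing all the eigenvalue equations and using the unit column sums shows that
    \<open>z\<close> fixes the coordinate sum, which vanishes as \<open>z\<close> is not 1.\<close>
  have "z * (\<Sum>i<n. x i) = (\<Sum>i<n. \<Sum>j<n. of_real (A_mat n $$ (i, j)) * x j)"
    by (simp add: x sum_distrib_left)
  also have "\<dots> = (\<Sum>j<n. of_real (\<Sum>i<n. A_mat n $$ (i, j)) * x j)"
    by (subst sum.swap) (simp add: sum_distrib_right)
  also have "\<dots> = (\<Sum>j<n. x j)"
    by (simp add: A_mat_column_sum del: of_real_sum)
  finally have sum0: "(\<Sum>j<n. x j) = 0" using z by auto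
  then have tail: "(\<Sum>j=2..<n. x j) = - x 0 - x 1"
    by (simp add: sum_split_first_two add_eq_0_iff algebra_simps)
  define k where "k = x 0 / of_real (m + 1)"
  have x0: "x 0 = of_real (m + 1) * k"
    using m_gt_1 by (simp add: k_def del: of_real_add)
  \<comment> \<open>Once \<open>tail\<close> is substituted, \<open>g\<close> is the coefficient of
    \<open>x 1\<close> in every middle row; \<open>f - c\<close> plays that role in the last row and
    equals \<open>g\<close>.\<close>
  define g where "g = c - e"
  have rel: "b = (m + 1) * g" "g = (m + 1) * e" "f - c = g" "(m + 1) * (b - c) = a" "d - e = a + g"
    unfolding g_def entry_relations(1-5) by (simp_all add: algebra_simps power2_eq_square power3_eq_cube)
  \<comment> \<open>This is the first row divided by \<open>m + 1\<close>, since
    \<open>b = (m + 1) * g\<close> and \<open>x 0 = (m + 1) * k\<close>.\<close>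
  have g: "of_real g * x 1 = (z - of_real a) * k"
  proof -
    have "of_real (m + 1) * (of_real g * x 1) = of_real b * x 1"
      by (simp add: rel(1))
    also have "\<dots> = (z - of_real a) * x 0"
      using A_mat_row_first[of x] x[of 0] n_ge_3 by (simp add: algebra_simps)
    also have "\<dots> = of_real (m + 1) * ((z - of_real a) * k)"
      by (simp add: x0)
    finally show ?thesis using m_gt_1 by (simp del: of_real_add)
  qed
  have step: "of_real (d - e) * (x (Suc i) - k) = z * (x i - k)" if "0 < i" "i < n - 1" for i
  proof -
    have "z * x i = of_real c * x 1 + of_real e * (- x 0 - x 1) + of_real (d - e) * x (Suc i)"
      using A_mat_row_middle[OF that, of x] x[of i] that tail by simp
    also have "\<dots> = of_real g * x 1 - of_real ((m + 1) * e) * k + of_real (d - e) * x (Suc i)"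
      unfolding g_def x0 by (simp add: algebra_simps)
    \<comment> \<open>The coefficient of \<open>k\<close> is \<open>z - a - g\<close>, and
      \<open>a + g = d - e\<close>.\<close>
    also have "\<dots> = (z - of_real (d - e)) * k + of_real (d - e) * x (Suc i)"
      unfolding g rel(2)[symmetric] rel(5) by (simp add: algebra_simps)
    finally show ?thesis by (simp add: algebra_simps)
  qed
  have last: "x (n - 1) = k"
  proof -
    have "z * x (n - 1) = of_real b * x 0 + of_real f * x 1 + of_real c * (- x 0 - x 1)"
      using A_mat_row_last[of x] x[of "n - 1"] n_ge_3 tail by simp
    also have "\<dots> = of_real ((m + 1) * (b - c)) * k + of_real (f - c) * x 1"
      unfolding x0 by (simp add: algebra_simps)
    also have "\<dots> = z * k"
      unfolding rel(3,4) g by (simp add: algebra_simps)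
    finally show ?thesis using z by simp
  qed
  \<comment> \<open>Downward induction from the last coordinate: if \<open>x (Suc i) = k\<close>,
    then \<open>step\<close> gives \<open>z * (x i - k) = 0\<close>, and \<open>z\<close>
    cancels.\<close>
  have const: "x i = k" if "1 \<le> i" "i \<le> n - 1" for i
    using that(2,1)
  proof (induction i rule: inc_induct)
    case base
    show ?case by (rule last)
  next
    case (step i)
    then have "z * (x i - k) = 0"
      using \<open>\<And>i. 0 < i \<Longrightarrow> i < n - 1 \<Longrightarrow> of_real (d - e) * (x (Suc i) - k) = z * (x i - k)\<close>[of i]
      by simp
    then show ?case using z by simp
  qed
  have "(\<Sum>j=2..<n. x j) = (\<Sum>j=2..<n. k)"
    by (intro sum.cong const) auto
  also have "\<dots> = of_real (m^2 - 2) * k"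
    using n_ge_3 by (simp add: of_nat_diff flip: real_n)
  finally have "of_real (m^2 - 2) * k = - x 0 - k"
    using tail const[of 1] n_ge_3 by simp
  \<comment> \<open>Collecting the coefficients of \<open>k\<close> gives
    \<open>(m^2 - 2) + (m + 1) + 1 = m * (m + 1)\<close>.\<close>
  then have "of_real (m * (m + 1)) * k = 0"
    unfolding x0 by (simp add: algebra_simps power2_eq_square)
  then have "k = 0" using m_gt_1 by (simp del: of_real_mult of_real_add)
  have "x i = 0" if "i < n" for i
    using const[of i] x0 \<open>k = 0\<close> that by (cases "i = 0") auto
  with nz show False by blast
qed

lemma A_mat_nontrivial_eigenvalues:
  assumes "z \<in># nontrivial_eigenvalues (A_mat n)"
  shows "z = 0"
proof -
  let ?A = "map_mat complex_of_real (A_mat n)"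
  have A: "?A \<in> carrier_mat n n" using A_mat_carrier by simp
  have "of_nat (count (proots (char_poly ?A)) 1) = (\<Sum>i<n. ?A $$ (i, i))"
    using count_one_char_poly_roots_eq_trace[OF A A_mat_eigenvalue] .
  also have "\<dots> = of_real (\<Sum>i<n. A_mat n $$ (i, i))"
    using A_mat_carrier by simp
  \<comment> \<open>Trace 1 makes the eigenvalue 1 simple, so removing one copy of it leaves
    none.\<close>
  finally have "count (proots (char_poly ?A)) 1 = 1"
    by (simp add: A_mat_trace del: count_proots)
  then have "z \<noteq> 1"
    using assms unfolding nontrivial_eigenvalues_def
    by (auto simp flip: count_greater_zero_iff simp del: count_proots)
  moreover have "eigenvalue ?A z"
  proof -
    have "z \<in># proots (char_poly ?A)"
      using assms unfolding nontrivial_eigenvalues_def by (rule in_diffD)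
    then show ?thesis
      unfolding eigenvalue_root_char_poly[OF A] by (cases "char_poly ?A = 0") auto
  qed
  ultimately show ?thesis using A_mat_eigenvalue by blast
qed

section \<open>Edge expansion of the matrix\<close>

lemma A_mat_lower_bound:
  assumes "i < n" "j < n"
  shows "(if i \<noteq> 0 \<and> j \<noteq> 0 then e else 0) + (if j = Suc i mod n then b else 0) \<le> A_mat n $$ (i, j)"
proof -
  have "e \<le> c" "e \<le> f"
    using entries_pos(5) m_gt_1 by (auto simp: entry_relations(1-5))
  \<comment> \<open>Both contributions meet only at the entries \<open>d\<close>: the other two
    cycle edges, \<open>(0, 1)\<close> and \<open>(n - 1, 0)\<close>, touch index 0 and carry
    \<open>b\<close> alone.\<close>
  moreover have "e + b \<le> d"
  proof -
    have "d - (e + b) = (m - 1) * (m + 1)^2 * e"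
      unfolding entry_relations(1-5) by (simp add: algebra_simps power2_eq_square power3_eq_cube)
    also have "\<dots> \<ge> 0" using entries_pos(5) m_gt_1 by simp
    finally show ?thesis by simp
  qed
  moreover have "Suc i mod n = (if i = n - 1 then 0 else Suc i)" using assms by auto
  ultimately show ?thesis
    using assms n_ge_3 entries_pos by (auto simp: A_mat_index)
qed

lemma A_mat_cut_lower_bound:
  assumes S: "S \<subseteq> {..<n}" "S \<noteq> {}" "real (card S) \<le> real n / 2"
  shows "(real (card S) - 1) * (real n - real (card S)) * e + b
    \<le> (\<Sum>i\<in>S. \<Sum>j\<in>{..<n} - S. A_mat n $$ (i, j))"
proof -
  let ?T = "{..<n} - S"
  let ?s = "real (card S)"
  have fin: "finite S" "finite ?T" using S(1) finite_subset by auto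
  have cT: "real (card ?T) = real n - ?s"
    using S(1) card_mono[OF _ S(1)] by (simp add: card_Diff_subset fin of_nat_diff)
  have s1: "card S \<ge> 1" using S(2) fin by (simp add: Suc_le_eq card_gt_0_iff)
  have "S \<noteq> {..<n}" using S(3) n_ge_3 by auto
  from cyclic_successor_leaves_proper_subset[OF S(1,2) this]
  obtain i0 where i0: "i0 \<in> S" "Suc i0 mod n \<in> ?T" .
  \<comment> \<open>If \<open>0 \<notin> S\<close>, the product is \<open>s (n - s - 1)\<close>, which is the larger one because \<open>2 s \<le> n\<close>.\<close>
  have "(?s - 1) * (real n - ?s) \<le> real (card (S - {0})) * real (card (?T - {0}))"
  proof (cases "0 \<in> S")
    case True
    then have "?T - {0} = ?T" by auto
    then show ?thesis using True s1 cT fin by (simp add: card_Diff_singleton of_nat_diff)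
  next
    case False
    then have "0 \<in> ?T" using n_ge_3 by auto
    then have "card ?T \<ge> 1" using fin(2) card_gt_0_iff[of ?T] by (metis One_nat_def Suc_leI empty_iff)
    with \<open>0 \<in> ?T\<close> have "real (card (?T - {0})) = real n - ?s - 1"
      using cT fin by (simp only: card_Diff_singleton of_nat_diff of_nat_1)
    moreover have "(?s - 1) * (real n - ?s) \<le> ?s * (real n - ?s - 1)"
      using S(3) by (simp add: algebra_simps)
    moreover have "S - {0} = S" using False by auto
    ultimately show ?thesis by (simp only:)
  qed
  then have "(?s - 1) * (real n - ?s) * e + b \<le> real (card (S - {0})) * real (card (?T - {0})) * e + b"
    using entries_pos(5) by simp
  also have "real (card (S - {0})) * real (card (?T - {0})) * e =
      (\<Sum>i\<in>S. \<Sum>j\<in>?T. if i \<noteq> 0 \<and> j \<noteq> 0 then e else 0)"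
  proof -
    have "(\<Sum>i\<in>S. \<Sum>j\<in>?T. if i \<noteq> 0 \<and> j \<noteq> 0 then e else 0) =
        (\<Sum>i\<in>S - {0}. \<Sum>j\<in>?T - {0}. e)"
      using fin by (intro sum.mono_neutral_cong_right) auto
    then show ?thesis by simp
  qed
  also have "b \<le> (\<Sum>i\<in>S. \<Sum>j\<in>?T. if j = Suc i mod n then b else 0)"
  proof -
    \<comment> \<open>The cycle edge leaving \<open>S\<close> at \<open>i0\<close> already
      contributes \<open>b\<close>, and all other terms are nonnegative.\<close>
    have "b = (\<Sum>j\<in>?T. if j = Suc i0 mod n then b else 0)"
      using i0 fin by simp
    also have "\<dots> \<le> (\<Sum>i\<in>S. \<Sum>j\<in>?T. if j = Suc i mod n then b else 0)"
      using i0 fin entries_pos(2)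
      by (intro member_le_sum[where f = "\<lambda>i. \<Sum>j\<in>?T. if j = Suc i mod n then b else 0"]) (auto intro!: sum_nonneg)
    finally show ?thesis .
  qed
  also have "(\<Sum>i\<in>S. \<Sum>j\<in>?T. if i \<noteq> 0 \<and> j \<noteq> 0 then e else 0) +
      (\<Sum>i\<in>S. \<Sum>j\<in>?T. if j = Suc i mod n then b else 0) =
      (\<Sum>i\<in>S. \<Sum>j\<in>?T. (if i \<noteq> 0 \<and> j \<noteq> 0 then e else 0) + (if j = Suc i mod n then b else 0))"
    by (simp only: sum.distrib)
  also have "\<dots> \<le> (\<Sum>i\<in>S. \<Sum>j\<in>?T. A_mat n $$ (i, j))"
    using S(1) by (intro sum_mono A_mat_lower_bound) auto
  finally show ?thesis by simp
qed

text \<open>This is \<open>s / (6 * m) \<le> (s - 1) * (n - s) * e + b\<close> with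
  \<open>n = m^2\<close> and denominators cleared.\<close>

lemma cut_polynomial_bound:
  assumes s: "1 \<le> s" "s \<le> m^2 / 2"
  shows "s * ((m + 1) * (m + 2)) \<le> 6 * ((s - 1) * (m^2 - s) + (m + 1)^2)"
proof -
  \<comment> \<open>Splitting \<open>m^2 - s\<close> into \<open>(m^2 / 2 - s) + m^2 / 2\<close>
    isolates a product of nonnegative factors; adding and subtracting \<open>4 * s\<close> then
    makes the remaining factor of \<open>s\<close> equal to \<open>2 * m^2 - 3 * m + 2\<close>,
    which is positive by completing the square.\<close>
  have "6 * ((s - 1) * (m^2 - s) + (m + 1)^2) - s * ((m + 1) * (m + 2)) =
      6 * ((s - 1) * (m^2 / 2 - s)) + 2 * (s * ((m - 3 / 4)^2 + 7 / 16)) +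
      4 * (m^2 / 2 - s) + (m^2 + 12 * m + 6)"
    by (simp add: field_simps power2_eq_square)
  also have "\<dots> \<ge> 0"
    using s m_gt_1 by (intro add_nonneg_nonneg mult_nonneg_nonneg) auto
  finally show ?thesis by simp
qed

lemma A_mat_edge_expansion_ge: "1 / (6 * m) \<le> edge_expansion (A_mat n)"
proof (rule edge_expansion_ge[OF A_mat_carrier])
  show "n \<ge> 2" using n_ge_3 by simp
  fix S assume S: "S \<subseteq> {..<n}" "S \<noteq> {}" "real (card S) \<le> real n / 2"
  let ?s = "real (card S)"
  have "card S > 0" using S finite_subset by (auto simp: card_gt_0_iff)
  then have s: "1 \<le> ?s" "?s \<le> m^2 / 2" using S(3) real_n by auto
  have "6 * m * ((?s - 1) * (real n - ?s) * e + b) =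
      m * e * (6 * ((?s - 1) * (m^2 - ?s) + (m + 1)^2))"
    unfolding entry_relations(2) real_n by (simp add: algebra_simps)
  also have "\<dots> \<ge> m * e * (?s * ((m + 1) * (m + 2)))"
    using cut_polynomial_bound[OF s] m_gt_1 entries_pos(5) by (intro mult_left_mono) auto
  also have "m * e * (?s * ((m + 1) * (m + 2))) = ?s * (m * (m + 1) * (m + 2) * e)"
    by (simp add: algebra_simps)
  finally have "?s \<le> 6 * m * ((?s - 1) * (real n - ?s) * e + b)"
    using entry_relations(6) by simp
  also have "\<dots> \<le> 6 * m * (\<Sum>i\<in>S. \<Sum>j\<in>{..<n} - S. A_mat n $$ (i, j))"
    using A_mat_cut_lower_bound[OF S] m_gt_1 by simp
  finally show "1 / (6 * m) \<le> (\<Sum>i\<in>S. \<Sum>j\<in>{..<n} - S. A_mat n $$ (i, j)) / ?s"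
    using s m_gt_1 by (simp add: field_simps)
qed

lemma A_mat_edge_expansion_le: "edge_expansion (A_mat n) \<le> 1 / m"
proof -
  have "edge_expansion (A_mat n) \<le> (\<Sum>i\<in>{0}. \<Sum>j\<in>{..<n} - {0}. A_mat n $$ (i, j)) / real (card {0::nat})"
    using n_ge_3 by (intro edge_expansion_le[OF A_mat_carrier]) auto
  also have "\<dots> = (\<Sum>j<n. A_mat n $$ (0, j)) - A_mat n $$ (0, 0)"
    using n_ge_3 by (simp add: sum_diff1)
  \<comment> \<open>The row sums to 1 and its diagonal entry is \<open>a = 1 - b\<close>.\<close>
  also have "\<dots> = b"
    using n_ge_3 first_line_sum A_mat_row_sum[of 0] by (simp add: A_mat_index)
  also have "b \<le> 1 / m"
    unfolding b_def using m_gt_1 by (simp add: divide_simps)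
  finally show ?thesis .
qed

lemma A_mat_Re_lambda2: "Re (lambda2 (A_mat n)) = 0"
proof -
  have "lambda2 (A_mat n) \<in># nontrivial_eigenvalues (A_mat n)"
    using n_ge_3 by (intro lambda2_in_nontrivial_eigenvalues[OF A_mat_carrier]) simp
  then have "lambda2 (A_mat n) = 0" by (rule A_mat_nontrivial_eigenvalues)
  then show ?thesis by simp
qed

end

theorem theorem16:
  fixes n :: nat
  assumes "n \<ge> 3"
  shows "doubly_stochastic n (A_mat n)
    \<and> (\<forall>z \<in># nontrivial_eigenvalues (A_mat n). z = 0)
    \<and> 1 / (6 * sqrt (real n)) \<le> edge_expansion (A_mat n)
    \<and> edge_expansion (A_mat n) \<le> 1 / sqrt (real n)
    \<and> edge_expansion (A_mat n) \<le> (1 - Re (lambda2 (A_mat n))) / sqrt (real n)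
    \<and> Gamma_ratio n \<le> 1 / sqrt (real n)"
proof -
  define m where "m = sqrt (real n)"
  interpret extremal_matrix n m "(m^2 + m - 1) / (m * (m + 2))" "(m + 1) / (m * (m + 2))"
    "1 / (m * (m + 1))" "(m^3 + 2 * m^2 + m + 1) / (m * (m + 1) * (m + 2))"
    "1 / (m * (m + 1) * (m + 2))" "(2 * m + 3) / (m * (m + 1) * (m + 2))"
    using assms by unfold_locales (simp_all add: m_def)
  have "Gamma_ratio n \<le> edge_expansion (A_mat n)"
    using Gamma_ratio_le[OF A_mat_doubly_stochastic] A_mat_Re_lambda2 assms by simp
  then show ?thesis
    using A_mat_doubly_stochastic A_mat_nontrivial_eigenvalues A_mat_edge_expansion_ge
      A_mat_edge_expansion_le A_mat_Re_lambda2
    unfolding m_def[symmetric] by auto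
qed

end
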